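(* Let $P,S$ be two logically independent events. The imprecise assessment $[0,1]^2$ on $\mathcal F=(P|S,\ S|P)$ is t-coherent; that is, every precise assessment $(x,y)\in[0,1]^2$ on $(P|S,S|P)$ is coherent.
   Context: Events are elements of a Boolean algebra (e.g. subsets of a set $\Omega$), identified with their $\{0,1\}$-valued indicators; $\overline{E}$ is the negation of $E$ and juxtaposition or $\wedge$ is conjunction. Two events $P,S$ are logically independent if all $4$ conjunctions $PS,P\overline{S},\overline{P}S,\overline{P}\,\overline{S}$ are different from the impossible event $\bot$. For events $E,H$ with $H\ne\bot$, the conditional event $E|H$ is true if $EH$ is true, false if $\overline{E}H$ is true, and void if $H$ is false. Coherence: an assessment $\mathcal P=(p_1,\dots,p_n)\in\mathbb R^n$ on $\mathcal F=(E_1|H_1,\dots,E_n|H_n)$ is coherent if for every nonempty $J\subseteq\{1,\dots,n\}$ and all real numbers $s_j$ ($j\in J$), the random gain $G=\sum_{j\in J}s_jH_j(E_j-p_j)$, restricted to $\bigvee_{j\in J}H_j$ (i.e. considering only its values when at least one $H_j$, $j\in J$, is true), has minimum $\le 0$ and maximum $\ge 0$. An imprecise assessment on $\mathcal F$ is a set $\mathcal I\subseteq[0,1]^n$; it is t-coherent (totally coherent) if it is nonempty and every $\mathcal P\in\mathcal I$ is a coherent assessment on $\mathcal F$. *)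

theory Defs
  imports Complex_Main
begin

definition logically_independent :: "'a::boolean_algebra \<Rightarrow> 'a \<Rightarrow> bool" where
  "logically_independent P S \<longleftrightarrow>
     inf P S \<noteq> bot \<and> inf P (- S) \<noteq> bot \<and> inf (- P) S \<noteq> bot \<and> inf (- P) (- S) \<noteq> bot"

text \<open>
  The pair does not by itself enforce that the conditioning event is possible; this is
  required in \<open>coherent\<close> below.
\<close>

datatype 'a cond_event = Given (event: 'a) (conditioning: 'a) (infix "given" 60)

text \<open>
  In an abstract Boolean algebra there are no points at which to evaluate indicators. Their role
  is played by the constituents: the possible (non-bottom) conjunctions obtained by choosing,
  for each of the finitely many events involved, the event or its negation.
  A constituent entails each of these events or its negation, so the indicator of such an
  event has a definite value on it.
\<close>

definition literal :: "bool \<Rightarrow> 'a::boolean_algebra \<Rightarrow> 'a" where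
  "literal b X = (if b then X else - X)"

definition conjunction :: "'a::boolean_algebra list \<Rightarrow> 'a" where
  "conjunction Xs = foldr inf Xs top"

definition constituents :: "'a::boolean_algebra list \<Rightarrow> 'a set" where
  "constituents Xs =
     {conjunction (map2 literal bs Xs) | bs. length bs = length Xs} - {bot}"

definition ind :: "'a::boolean_algebra \<Rightarrow> 'a \<Rightarrow> real" where
  "ind X C = of_bool (C \<le> X)"

definition family_constituents :: "'a::boolean_algebra cond_event list \<Rightarrow> 'a set" where
  "family_constituents F = constituents (map event F @ map conditioning F)"

text \<open>Families and assessments are lists; their members are indexed from 0.\<close>

definition gain ::
  "'a::boolean_algebra cond_event list \<Rightarrow> real list \<Rightarrow> nat set \<Rightarrow> (nat \<Rightarrow> real) \<Rightarrow> 'a \<Rightarrow> real" where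
  "gain F p J s C =
     (\<Sum>j\<in>J. s j * ind (conditioning (F ! j)) C * (ind (event (F ! j)) C - p ! j))"

text \<open>The values of the gain when at least one conditioning event with index in \<open>J\<close> is true.\<close>

definition gain_values ::
  "'a::boolean_algebra cond_event list \<Rightarrow> real list \<Rightarrow> nat set \<Rightarrow> (nat \<Rightarrow> real) \<Rightarrow> real set" where
  "gain_values F p J s =
     gain F p J s ` {C \<in> family_constituents F. \<exists>j\<in>J. C \<le> conditioning (F ! j)}"

definition coherent :: "'a::boolean_algebra cond_event list \<Rightarrow> real list \<Rightarrow> bool" where
  "coherent F p \<longleftrightarrow>
     length p = length F \<and>
     (\<forall>X\<in>set F. conditioning X \<noteq> bot) \<and>
     (\<forall>J s. J \<subseteq> {..<length F} \<and> J \<noteq> {} \<longrightarrow>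
        Min (gain_values F p J s) \<le> 0 \<and> Max (gain_values F p J s) \<ge> 0)"

definition unit_cube :: "nat \<Rightarrow> real list set" where
  "unit_cube n = {p. length p = n \<and> set p \<subseteq> {0..1}}"

definition t_coherent :: "'a::boolean_algebra cond_event list \<Rightarrow> real list set \<Rightarrow> bool" where
  "t_coherent F I \<longleftrightarrow> I \<subseteq> unit_cube (length F) \<and> I \<noteq> {} \<and> (\<forall>p\<in>I. coherent F p)"

text \<open>
  \<open>Min\<close> and \<open>Max\<close> in \<open>coherent\<close> are applied to finite nonempty sets only.
\<close>

lemma finite_gain_values: "finite (gain_values F p J s)"
proof -
  have "finite {bs :: bool list. length bs = n}" for n
    using finite_lists_length_eq[of "UNIV :: bool set" n] by simp
  then have "finite (constituents Xs)" for Xs :: "'a list"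
    unfolding constituents_def by (intro finite_Diff) simp
  then show ?thesis
    by (simp add: gain_values_def family_constituents_def)
qed

lemma constituent_below:
  assumes "Y \<noteq> bot"
  shows "\<exists>bs. length bs = length Xs \<and> inf Y (conjunction (map2 literal bs Xs)) \<noteq> bot"
  using assms
proof (induction Xs arbitrary: Y)
  case Nil
  then show ?case by (simp add: conjunction_def)
next
  case (Cons X Xs)
  have "sup (inf Y X) (inf Y (- X)) = Y"
    by (simp flip: inf_sup_distrib1)
  with Cons.prems obtain b where "inf Y (literal b X) \<noteq> bot"
    by (metis literal_def sup_bot.right_neutral)
  from Cons.IH[OF this] obtain bs where
    "length bs = length Xs" "inf (inf Y (literal b X)) (conjunction (map2 literal bs Xs)) \<noteq> bot"
    by blast
  then show ?case
    by (intro exI[of _ "b # bs"]) (simp add: conjunction_def inf.assoc)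
qed

lemma conjunction_le: "X \<in> set Xs \<Longrightarrow> conjunction Xs \<le> X"
  by (induction Xs) (auto simp: conjunction_def intro: le_infI2)

lemma constituent_decides:
  assumes "length bs = length Xs" "i < length Xs"
  shows "conjunction (map2 literal bs Xs) \<le> literal (bs ! i) (Xs ! i)"
  using assms conjunction_le[OF nth_mem, of i "map2 literal bs Xs"] by simp

lemma gain_values_nonempty:
  assumes "j \<in> J" "j < length F" "conditioning (F ! j) \<noteq> bot"
  shows "gain_values F p J s \<noteq> {}"
proof -
  let ?Xs = "map event F @ map conditioning F"
  from constituent_below[OF assms(3)] obtain bs where bs: "length bs = length ?Xs"
    and ne: "inf (conditioning (F ! j)) (conjunction (map2 literal bs ?Xs)) \<noteq> bot" (is "inf _ ?C \<noteq> _")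
    by blast
  have "?C \<le> literal (bs ! (length F + j)) (conditioning (F ! j))"
    using constituent_decides[OF bs, of "length F + j"] assms(2) by (simp add: nth_append)
  then have "?C \<le> conditioning (F ! j)"
    using ne by (cases "bs ! (length F + j)") (auto simp: literal_def[of False] literal_def[of True] inf_shunt
        dest: compl_le_swap1)
  moreover have "?C \<in> family_constituents F"
    using bs ne by (auto simp: family_constituents_def constituents_def)
  ultimately show ?thesis
    using assms(1) by (auto simp: gain_values_def)
qed

text \<open>
  For events that are subsets of a sample space, the values are the pointwise ones.
\<close>

lemma mem_conjunction: "w \<in> conjunction Xs \<longleftrightarrow> (\<forall>X\<in>set Xs. w \<in> X)"
  by (induction Xs) (auto simp: conjunction_def)

lemma gain_values_set:
  fixes F :: "'w set cond_event list"
  assumes "J \<subseteq> {..<length F}"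
  shows "gain_values F p J s =
    (\<lambda>w. \<Sum>j\<in>J. s j * of_bool (w \<in> conditioning (F ! j)) *
             (of_bool (w \<in> event (F ! j)) - p ! j)) ` (\<Union>j\<in>J. conditioning (F ! j))"
    (is "_ = ?g ` ?H")
proof -
  let ?Xs = "map event F @ map conditioning F"
  have le: "C \<subseteq> X \<longleftrightarrow> w \<in> X" if C: "C \<in> family_constituents F" "w \<in> C" "X \<in> set ?Xs" for C w X
  proof -
    from C obtain bs where bs: "length bs = length ?Xs" "C = conjunction (map2 literal bs ?Xs)"
      by (auto simp: family_constituents_def constituents_def)
    from C(3) obtain i where i: "i < length ?Xs" "X = ?Xs ! i"
      by (metis in_set_conv_nth)
    have "C \<subseteq> literal (bs ! i) X"
      using constituent_decides[OF bs(1) i(1)] bs i by simp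
    with C(2) show ?thesis
      by (auto simp: literal_def split: if_splits)
  qed
  have ev: "event (F ! j) \<in> set ?Xs" "conditioning (F ! j) \<in> set ?Xs" if "j \<in> J" for j
    using that assms by auto
  have g: "gain F p J s C = ?g w" if "C \<in> family_constituents F" "w \<in> C" for C w
    unfolding gain_def ind_def using le[OF that] ev by (intro sum.cong) auto
  have ex: "\<exists>C\<in>family_constituents F. w \<in> C" for w
  proof -
    let ?C = "conjunction (map2 literal (map (\<lambda>X. w \<in> X) ?Xs) ?Xs)"
    have "w \<in> ?C"
      unfolding mem_conjunction by (auto simp: literal_def in_set_zip nth_append)
    then show ?thesis
      by (intro bexI[of _ ?C])
        (auto simp: family_constituents_def constituents_def simp del: map_append
          intro!: exI[of _ "map (\<lambda>X. w \<in> X) ?Xs"])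
  qed
  show ?thesis
  proof (intro equalityI subsetI)
    fix r assume "r \<in> gain_values F p J s"
    then obtain C j where C: "C \<in> family_constituents F" "j \<in> J" "C \<subseteq> conditioning (F ! j)"
      "r = gain F p J s C"
      by (auto simp: gain_values_def)
    from C(1) obtain w where "w \<in> C"
      by (auto simp: family_constituents_def constituents_def)
    then have "r = ?g w" "w \<in> ?H"
      using C g[OF C(1)] by auto
    then show "r \<in> ?g ` ?H" by (rule image_eqI)
  next
    fix r assume "r \<in> ?g ` ?H"
    then obtain w j where w: "j \<in> J" "w \<in> conditioning (F ! j)" "r = ?g w" by blast
    from ex[of w] obtain C where "C \<in> family_constituents F" "w \<in> C" by blast
    have C: "C \<in> family_constituents F" "w \<in> C" by fact+
    then have "C \<subseteq> conditioning (F ! j)"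
      using le[OF C ev(2)[OF w(1)]] w(2) by simp
    moreover have "r = gain F p J s C"
      using g[OF C] w(3) by simp
    ultimately show "r \<in> gain_values F p J s"
      using C(1) w(1) by (auto simp: gain_values_def)
  qed
qed

end

theory Submission
  imports Defs
begin

text \<open>
  On \<open>(P|S, S|P)\<close> a gain with stakes \<open>s\<^sub>0, s\<^sub>1\<close> has the three values
  \<open>s\<^sub>0 (1 - x) + s\<^sub>1 (1 - y)\<close> on \<open>P S\<close>, \<open>- s\<^sub>0 x\<close> on the constituent where only \<open>S\<close> is true, and
  \<open>- s\<^sub>1 y\<close> on the one where only \<open>P\<close> is true. The two conditionals never lose together: each
  conditioning event is the other conditioned event, so a bet that is lost leaves the other one
  void. Hence any nonnegative stake, when its bet is lost, gives a gain \<open>\<le> 0\<close> all by itself; and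
  if all stakes are negative, then the gain is \<open>\<le> 0\<close> on \<open>P S\<close>, where every bet is won.

  This bounds the minimum of every gain, and the maximum follows because changing the
  sign of all stakes changes the sign of the gain (\<open>coherentI\<close>). Logical independence guarantees
  that the three constituents are possible, so that the values are really attained.
\<close>

text \<open>
  Coherence needs only the half that concerns the minimum: a gain that is positive
  throughout can be exchanged for one that is negative throughout by reversing all stakes.
\<close>

lemma coherentI:
  assumes "length p = length F"
    and "\<And>X. X \<in> set F \<Longrightarrow> conditioning X \<noteq> bot"
    and no_sure_gain: "\<And>J s. J \<subseteq> {..<length F} \<Longrightarrow> J \<noteq> {} \<Longrightarrow>
      \<exists>C\<in>family_constituents F. (\<exists>j\<in>J. C \<le> conditioning (F ! j)) \<and> gain F p J s C \<le> 0"
  shows "coherent F p"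
proof -
  have "Min (gain_values F p J s) \<le> 0 \<and> Max (gain_values F p J s) \<ge> 0"
    if J: "J \<subseteq> {..<length F}" "J \<noteq> {}" for J s
  proof
    have "\<exists>r\<in>gain_values F p J s. r \<le> 0"
      using no_sure_gain[OF J, of s] by (auto simp: gain_values_def)
    then show "Min (gain_values F p J s) \<le> 0"
      by (meson Min_le finite_gain_values order_trans)
  next
    have "gain F p J (\<lambda>j. - s j) C = - gain F p J s C" for C
      by (simp add: gain_def sum_negf)
    then have "\<exists>r\<in>gain_values F p J s. r \<ge> 0"
      using no_sure_gain[OF J, of "\<lambda>j. - s j"] by (auto simp: gain_values_def)
    then show "Max (gain_values F p J s) \<ge> 0"
      by (meson Max_ge finite_gain_values order_trans)
  qed
  with assms(1,2) show ?thesis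
    by (simp add: coherent_def)
qed

lemma ind_eq_of_bool:
  assumes "C \<noteq> bot" "C \<le> literal b X"
  shows "ind X C = of_bool b"
proof (cases b)
  case False
  then have "\<not> C \<le> X"
    using assms by (metis literal_def inf.bounded_iff inf_compl_bot bot.extremum_uniqueI)
  with False show ?thesis by (simp add: ind_def)
qed (use assms in \<open>simp add: ind_def literal_def\<close>)

text \<open>
  Both events occur twice in the list that generates the constituents of \<open>(P|S, S|P)\<close>. Choosing
  the same sign at both occurrences gives the constituents of \<open>P, S\<close>.
\<close>

lemma literal_pair_constituent:
  assumes "inf (literal a P) (literal b S) \<noteq> bot"
  shows "inf (literal a P) (literal b S) \<in> family_constituents [P given S, S given P]"
proof -
  have "inf (literal a P) (literal b S) =
      conjunction (map2 literal [a, b, b, a] [P, S, S, P])"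
    by (simp add: conjunction_def inf.commute inf.left_commute)
  with assms show ?thesis
    unfolding family_constituents_def constituents_def
    by (auto intro!: exI[of _ "[a, b, b, a]"])
qed

lemma coherent_swapped_conditionals:
  fixes P S :: "'a::boolean_algebra"
  assumes "logically_independent P S" and "0 \<le> x" "x \<le> 1" "0 \<le> y" "y \<le> 1"
  shows "coherent [P given S, S given P] [x, y]" (is "coherent ?F ?p")
proof (rule coherentI)
  show "conditioning X \<noteq> bot" if "X \<in> set ?F" for X
    using that assms(1) by (auto simp: logically_independent_def)
next
  fix J :: "nat set" and s :: "nat \<Rightarrow> real"
  assume "J \<subseteq> {..<length ?F}" "J \<noteq> {}"
  then have "J \<subseteq> {0, 1}" by auto
  with \<open>J \<noteq> {}\<close> have J: "J = {0} \<or> J = {1} \<or> J = {0, 1}"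
    by blast
  define C where "C a b = inf (literal a P) (literal b S)" for a b
  have ne: "C a b \<noteq> bot" for a b
    using assms(1) by (simp add: C_def literal_def logically_independent_def)
  have mem: "C a b \<in> family_constituents ?F" for a b
    using ne unfolding C_def by (rule literal_pair_constituent)
  have ind: "ind P (C a b) = of_bool a" "ind S (C a b) = of_bool b" for a b
    by (rule ind_eq_of_bool[OF ne], simp add: C_def)+
  have le: "C True b \<le> P" "C a True \<le> S" for a b
    by (simp_all add: C_def literal_def)
  note gain = gain_def ind
  consider "0 \<in> J" "0 \<le> s 0" | "1 \<in> J" "0 \<le> s 1" | "\<forall>j\<in>J. s j < 0"
    using J by force
  then show "\<exists>C\<in>family_constituents ?F.
      (\<exists>j\<in>J. C \<le> conditioning (?F ! j)) \<and> gain ?F ?p J s C \<le> 0"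
  proof cases
    case 1
    have "gain ?F ?p J s (C False True) = - s 0 * x"
      using J 1 by (auto simp: gain)
    also have "\<dots> \<le> 0" using 1 assms by simp
    finally show ?thesis
      using 1 le mem by (intro bexI[of _ "C False True"] conjI bexI[of _ 0]) auto
  next
    case 2
    have "gain ?F ?p J s (C True False) = - s 1 * y"
      using J 2 by (auto simp: gain)
    also have "\<dots> \<le> 0" using 2 assms by simp
    finally show ?thesis
      using 2 le mem by (intro bexI[of _ "C True False"] conjI bexI[of _ 1]) auto
  next
    case 3
    have "gain ?F ?p J s (C True True) = (\<Sum>j\<in>J. s j * (1 - ?p ! j))"
      using J by (auto simp: gain)
    also have "\<dots> \<le> 0"
      using 3 J assms by (intro sum_nonpos mult_nonpos_nonneg) auto
    finally show ?thesis
      using J le mem by (intro bexI[of _ "C True True"] conjI) auto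
  qed
qed simp

theorem proposition7:
  fixes P S :: "'a::boolean_algebra"
  assumes "logically_independent P S"
  shows "t_coherent [P given S, S given P] (unit_cube 2) \<and>
         (\<forall>x\<in>{0..1}. \<forall>y\<in>{0..1}. coherent [P given S, S given P] [x, y])"
proof -
  have precise: "\<forall>x\<in>{0..1}. \<forall>y\<in>{0..1}. coherent [P given S, S given P] [x, y]"
    using coherent_swapped_conditionals[OF assms] by simp
  have "\<exists>x\<in>{0..1}. \<exists>y\<in>{0..1}. p = [x, y]" if "p \<in> unit_cube 2" for p
    using that by (auto simp: unit_cube_def numeral_2_eq_2 length_Suc_conv)
  moreover have "[0, 0] \<in> unit_cube 2"
    by (simp add: unit_cube_def)
  ultimately have "t_coherent [P given S, S given P] (unit_cube 2)"
    using precise by (fastforce simp: t_coherent_def numeral_2_eq_2)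
  with precise show ?thesis by blast
qed

end
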